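(* Let $X$ be a proper $\mathrm{CAT}(0)$ space and let $G$ be a finite subgroup of the isometry group $\mathrm{Isom}(X)$. Then the action of $G$ on $X$ is tame.
   Context: A (not necessarily continuous) map of metric spaces is coarse if preimages of bounded sets are bounded and for every $R>0$ there is $S_R>0$ with $d(x_1,x_2)\le R\Rightarrow d(f(x_1),f(x_2))\le S_R$. It is a coarse equivalence if there is a coarse map in the other direction such that both composites are at uniformly bounded distance from the identity maps. For a group $H$ acting on $(X,d)$ and $k\ge 0$ put $X^H_k=\{x\in X\mid d(x,hx)\le k\ \forall h\in H\}$ with the induced metric. The bounded fixed set $X^H_{bd}$ exists if there are $k_0>0$ and a subspace $Y\subset X^H_{k_0}$ such that the inclusion $Y\to X^H_k$ is a coarse equivalence for all $k\ge k_0$ (then $X^H_{bd}=Y$). The action of $G$ is tame if $X^H_{bd}$ exists for all subgroups $H\le G$. *)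

theory Defs
  imports "HOL-Analysis.Analysis" "HOL-Algebra.Group_Action"
begin

text \<open>A metric space is a subset \<open>X\<close> of a type of class \<open>metric_space\<close>, with the
  induced metric; \<open>X = UNIV\<close> is allowed.\<close>

definition proper_space :: "'a::metric_space set \<Rightarrow> bool" where
  "proper_space X \<longleftrightarrow> (\<forall>x\<in>X. \<forall>r. compact (cball x r \<inter> X))"

definition geodesic_segment :: "'a::metric_space set \<Rightarrow> 'a set \<Rightarrow> 'a \<Rightarrow> 'a \<Rightarrow> bool" where
  "geodesic_segment X S x y \<longleftrightarrow>
    (\<exists>l\<ge>0. \<exists>\<gamma>. \<gamma> \<in> {0..l::real} \<rightarrow> X \<and> \<gamma> 0 = x \<and> \<gamma> l = y \<and>
       (\<forall>s\<in>{0..l}. \<forall>t\<in>{0..l}. dist (\<gamma> s) (\<gamma> t) = \<bar>s - t\<bar>) \<and> S = \<gamma> ` {0..l})"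

definition geodesic_space :: "'a::metric_space set \<Rightarrow> bool" where
  "geodesic_space X \<longleftrightarrow> (\<forall>x\<in>X. \<forall>y\<in>X. \<exists>S. geodesic_segment X S x y)"

definition geodesic_triangle ::
    "'a::metric_space set \<Rightarrow> 'a \<Rightarrow> 'a \<Rightarrow> 'a \<Rightarrow> 'a set \<Rightarrow> 'a set \<Rightarrow> 'a set \<Rightarrow> bool" where
  "geodesic_triangle X p q r S T U \<longleftrightarrow>
    geodesic_segment X S p q \<and> geodesic_segment X T p r \<and> geodesic_segment X U q r"

definition comparison_triangle ::
    "'a::metric_space \<Rightarrow> 'a \<Rightarrow> 'a \<Rightarrow> real^2 \<Rightarrow> real^2 \<Rightarrow> real^2 \<Rightarrow> bool" where
  "comparison_triangle p q r p' q' r' \<longleftrightarrow>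
    dist p' q' = dist p q \<and> dist p' r' = dist p r \<and> dist q' r' = dist q r"

text \<open>\<open>x'\<close>, on the Euclidean side from \<open>p'\<close> to \<open>q'\<close>, is the comparison point of the point
  \<open>x\<close> of a geodesic side issuing from \<open>p\<close>.\<close>

definition comparison_point ::
    "'a::metric_space \<Rightarrow> 'a \<Rightarrow> real^2 \<Rightarrow> real^2 \<Rightarrow> real^2 \<Rightarrow> bool" where
  "comparison_point p x p' q' x' \<longleftrightarrow> x' \<in> closed_segment p' q' \<and> dist p' x' = dist p x"

text \<open>The comparison inequality is required for points on the two sides issuing from \<open>p\<close>.
  Since the vertices of a triangle may be permuted, this covers all pairs of different sides;
  for two points on the same side the inequality is an equality.\<close>

definition CAT0 :: "'a::metric_space set \<Rightarrow> bool" where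
  "CAT0 X \<longleftrightarrow> geodesic_space X \<and>
    (\<forall>p q r S T U p' q' r' x y x' y'.
       geodesic_triangle X p q r S T U \<longrightarrow> comparison_triangle p q r p' q' r' \<longrightarrow>
       x \<in> S \<longrightarrow> y \<in> T \<longrightarrow> comparison_point p x p' q' x' \<longrightarrow> comparison_point p y p' r' y' \<longrightarrow>
       dist x y \<le> dist x' y')"

definition coarse_map ::
    "'a::metric_space set \<Rightarrow> 'b::metric_space set \<Rightarrow> ('a \<Rightarrow> 'b) \<Rightarrow> bool" where
  "coarse_map A B f \<longleftrightarrow> f \<in> A \<rightarrow> B \<and>
    (\<forall>C\<subseteq>B. bounded C \<longrightarrow> bounded (f -` C \<inter> A)) \<and>
    (\<forall>R>0. \<exists>S>0. \<forall>x\<in>A. \<forall>y\<in>A. dist x y \<le> R \<longrightarrow> dist (f x) (f y) \<le> S)"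

definition coarse_equivalence ::
    "'a::metric_space set \<Rightarrow> 'b::metric_space set \<Rightarrow> ('a \<Rightarrow> 'b) \<Rightarrow> bool" where
  "coarse_equivalence A B f \<longleftrightarrow> coarse_map A B f \<and>
    (\<exists>g. coarse_map B A g \<and>
       (\<exists>c. \<forall>x\<in>A. dist (g (f x)) x \<le> c) \<and> (\<exists>c. \<forall>y\<in>B. dist (f (g y)) y \<le> c))"

definition almost_fixed ::
    "'a::metric_space set \<Rightarrow> ('g \<Rightarrow> 'a \<Rightarrow> 'a) \<Rightarrow> 'g set \<Rightarrow> real \<Rightarrow> 'a set" where
  "almost_fixed X \<phi> H k = {x \<in> X. \<forall>h\<in>H. dist x (\<phi> h x) \<le> k}"

definition is_bounded_fixed_set ::
    "'a::metric_space set \<Rightarrow> ('g \<Rightarrow> 'a \<Rightarrow> 'a) \<Rightarrow> 'g set \<Rightarrow> 'a set \<Rightarrow> bool" where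
  "is_bounded_fixed_set X \<phi> H Y \<longleftrightarrow>
    (\<exists>k\<^sub>0>0. Y \<subseteq> almost_fixed X \<phi> H k\<^sub>0 \<and>
       (\<forall>k\<ge>k\<^sub>0. coarse_equivalence Y (almost_fixed X \<phi> H k) (\<lambda>y. y)))"

definition tame_action ::
    "('g, 'm) monoid_scheme \<Rightarrow> 'a::metric_space set \<Rightarrow> ('g \<Rightarrow> 'a \<Rightarrow> 'a) \<Rightarrow> bool" where
  "tame_action G X \<phi> \<longleftrightarrow> (\<forall>H. subgroup H G \<longrightarrow> (\<exists>Y. is_bounded_fixed_set X \<phi> H Y))"

definition isometry_group :: "'a::metric_space set \<Rightarrow> ('a \<Rightarrow> 'a) monoid" where
  "isometry_group X =
    (BijGroup X)\<lparr>carrier := {f \<in> Bij X. \<forall>x\<in>X. \<forall>y\<in>X. dist (f x) (f y) = dist x y}\<rparr>"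

lemma subgroup_isometries:
  "subgroup {f \<in> Bij X. \<forall>x\<in>X. \<forall>y\<in>X. dist (f x) (f y) = dist x y} (BijGroup X)"
    (is "subgroup ?I _")
proof (rule group.subgroupI[OF group_BijGroup])
  show "?I \<subseteq> carrier (BijGroup X)" by (auto simp: BijGroup_def)
  have "(\<lambda>x\<in>X. x) \<in> ?I" by (auto simp: id_Bij)
  then show "?I \<noteq> {}" by blast
next
  fix f assume f: "f \<in> ?I"
  then have B: "f \<in> Bij X" by simp
  have im: "f ` X = X" using B by (simp add: Bij_def bij_betw_def)
  have "dist (inv_into X f x) (inv_into X f y) = dist x y" if "x \<in> X" "y \<in> X" for x y
  proof -
    have "inv_into X f x \<in> X" "inv_into X f y \<in> X"
      using that im by (auto intro: inv_into_into)
    then have "dist (f (inv_into X f x)) (f (inv_into X f y)) =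
        dist (inv_into X f x) (inv_into X f y)" using f by blast
    then show ?thesis using that im by (simp add: f_inv_into_f)
  qed
  then show "inv\<^bsub>BijGroup X\<^esub> f \<in> ?I"
    using B by (simp add: inv_BijGroup restrict_inv_into_Bij)
next
  fix f g assume f: "f \<in> ?I" and g: "g \<in> ?I"
  then have B: "f \<in> Bij X" "g \<in> Bij X" by auto
  then have "g x \<in> X" if "x \<in> X" for x
    using that by (auto simp: Bij_def bij_betw_def)
  with f g B show "f \<otimes>\<^bsub>BijGroup X\<^esub> g \<in> ?I"
    using compose_Bij[OF B] by (simp add: BijGroup_def compose_def)
qed

lemma group_isometry_group: "group (isometry_group X)"
  unfolding isometry_group_def
  by (rule group.subgroup_imp_group[OF group_BijGroup subgroup_isometries])

lemma isometry_subgroup_action: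
  assumes "subgroup G (isometry_group X)"
  shows "group_action ((isometry_group X)\<lparr>carrier := G\<rparr>) X (\<lambda>g. g)"
proof -
  have "G \<subseteq> carrier (isometry_group X)" using assms by (rule subgroup.subset)
  then have "(\<lambda>g. g) \<in> hom ((isometry_group X)\<lparr>carrier := G\<rparr>) (BijGroup X)"
    by (auto simp: hom_def isometry_group_def BijGroup_def)
  then show ?thesis
    using group.subgroup_imp_group[OF group_isometry_group assms] group_BijGroup
    by (simp add: group_action_def group_hom_def group_hom_axioms_def)
qed

end

theory Submission
  imports Defs
begin

text \<open>The bounded fixed set of \<open>H\<close> is its honest fixed set. For \<open>x \<in> X\<close> the function
  \<open>z \<mapsto> (\<Sum>h\<in>H. d(z, hx)\<^sup>2)\<close> attains its minimum since \<open>X\<close> is proper, and only once by the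
  Bruhat--Tits inequality; it is \<open>H\<close>-invariant, so its minimiser \<open>c\<close> is fixed by \<open>H\<close>. Then
  all distances \<open>d(c, hx)\<close> agree with \<open>d(c, x)\<close>, and comparison with the value at \<open>x\<close> gives
  \<open>d(c, x) \<le> k\<close> whenever \<open>x \<in> X\<^sup>H\<^sub>k\<close>. Hence \<open>X\<^sup>H\<close> is \<open>k\<close>-dense in \<open>X\<^sup>H\<^sub>k\<close>.\<close>

section \<open>Comparison triangles and the Bruhat-Tits inequality\<close>

lemma comparison_triangle_exists:
  fixes p q r :: "'a::metric_space"
  assumes "p \<noteq> q"
  obtains p' q' r' where "comparison_triangle p q r p' q' r'"
proof -
  define a b c where "a = dist p q" and "b = dist p r" and "c = dist q r"
  \<comment> \<open>With \<open>p'\<close> at the origin and \<open>q'\<close> on the first axis,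
    the law of cosines makes \<open>u\<close> the first coordinate of \<open>r'\<close>; dividing by
    \<open>a\<close> is where \<open>p \<noteq> q\<close> enters.\<close>
  define u where "u = (a\<^sup>2 + b\<^sup>2 - c\<^sup>2) / (2 * a)"
  define v where "v = sqrt (b\<^sup>2 - u\<^sup>2)"
  have a: "a > 0" and b: "b \<ge> 0" and c: "c \<ge> 0"
    using assms by (auto simp: a_def b_def c_def)
  have tri: "a \<le> b + c" "b \<le> a + c" "c \<le> a + b"
    unfolding a_def b_def c_def
    using dist_triangle[of p q r] dist_triangle[of p r q] dist_triangle[of q r p]
    by (simp_all add: dist_commute)
  \<comment> \<open>The first bound gives \<open>- b \<le> u\<close>, the second
    \<open>u \<le> b\<close>, so the root defining \<open>v\<close> is taken of a nonnegative
    number.\<close>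
  have "c\<^sup>2 \<le> (a + b)\<^sup>2" "(a - b)\<^sup>2 \<le> c\<^sup>2"
    using tri c abs_le_square_iff[of "a - b" c] by (auto intro: power_mono)
  then have "\<bar>u\<bar> \<le> b"
    using a unfolding u_def by (simp add: abs_le_iff field_simps power2_eq_square)
  then have "u\<^sup>2 \<le> b\<^sup>2" using abs_le_square_iff[of u b] b by simp
  then have v: "v\<^sup>2 = b\<^sup>2 - u\<^sup>2" by (simp add: v_def)
  have "2 * a * u = a\<^sup>2 + b\<^sup>2 - c\<^sup>2" using a by (simp add: u_def)
  then have w: "(a - u)\<^sup>2 + v\<^sup>2 = c\<^sup>2" unfolding v by (simp add: power2_diff)
  have "comparison_triangle p q r (0 :: real^2) (vector [a, 0]) (vector [u, v])"
    using a b c v w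
    by (simp add: comparison_triangle_def dist_norm norm_vec_def L2_set_def sum_2
        flip: a_def b_def c_def)
  then show thesis by (rule that)
qed

lemma geodesic_segment_ends:
  assumes "geodesic_segment X S x y"
  shows "x \<in> S" "y \<in> S"
  using assms by (force simp: geodesic_segment_def)+

lemma geodesic_segment_midpoint:
  assumes "geodesic_segment X S x y"
  obtains m where "m \<in> S" "m \<in> X" "dist x m = dist x y / 2" "dist y m = dist x y / 2"
proof -
  obtain l \<gamma> where l: "l \<ge> 0" and \<gamma>: "\<gamma> \<in> {0..l} \<rightarrow> X" "\<gamma> 0 = x" "\<gamma> l = y"
    and iso: "\<And>s t. s \<in> {0..l} \<Longrightarrow> t \<in> {0..l} \<Longrightarrow> dist (\<gamma> s) (\<gamma> t) = \<bar>s - t\<bar>"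
    and S: "S = \<gamma> ` {0..l}"
    using assms unfolding geodesic_segment_def by blast
  show thesis
  proof (rule that[of "\<gamma> (l / 2)"])
    show "\<gamma> (l / 2) \<in> S" "\<gamma> (l / 2) \<in> X" using l \<gamma> S by auto
    show "dist x (\<gamma> (l / 2)) = dist x y / 2" "dist y (\<gamma> (l / 2)) = dist x y / 2"
      using iso[of 0 "l / 2"] iso[of l "l / 2"] iso[of 0 l] l \<gamma>(2,3) by simp_all
  qed
qed

text \<open>Comparison reduces this to the median formula in the plane. The point \<open>m\<close>
  is the midpoint of a geodesic from \<open>p\<close> to \<open>q\<close>, chosen before
  \<open>r\<close>, so that one \<open>m\<close> serves every \<open>r\<close>.\<close>

lemma CAT0_Bruhat_Tits:
  assumes "CAT0 X" "p \<in> X" "q \<in> X" "p \<noteq> q"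
  obtains m where "m \<in> X"
    "\<And>r. r \<in> X \<Longrightarrow> (dist m r)\<^sup>2 \<le> ((dist p r)\<^sup>2 + (dist q r)\<^sup>2) / 2 - (dist p q)\<^sup>2 / 4"
proof -
  have geo: "\<exists>S. geodesic_segment X S x y" if "x \<in> X" "y \<in> X" for x y
    using assms(1) that by (auto simp: CAT0_def geodesic_space_def)
  obtain S where S: "geodesic_segment X S p q" using geo assms by blast
  obtain m where m: "m \<in> S" "m \<in> X" "dist p m = dist p q / 2"
    using geodesic_segment_midpoint[OF S] by blast
  show thesis
  proof (rule that[OF m(2)])
    fix r assume r: "r \<in> X"
    obtain T U where TU: "geodesic_segment X T p r" "geodesic_segment X U q r"
      using geo assms r by blast
    obtain p' q' r' :: "real^2" where tri: "comparison_triangle p q r p' q' r'"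
      using comparison_triangle_exists[OF assms(4)] by blast
    define m' where "m' = midpoint p' q'"
    have "geodesic_triangle X p q r S T U"
      using S TU by (simp add: geodesic_triangle_def)
    \<comment> \<open>The vertex \<open>r\<close> is treated as a point of the side
      \<open>T\<close>, so that \<open>m\<close> and \<open>r\<close> lie on the two sides issuing
      from \<open>p\<close>.\<close>
    moreover have "r \<in> T" using TU(1) by (rule geodesic_segment_ends)
    moreover have "comparison_point p m p' q' m'"
      using tri m(3)
      by (simp add: comparison_point_def comparison_triangle_def m'_def dist_midpoint)
    moreover have "comparison_point p r p' r' r'"
      using tri by (simp add: comparison_point_def comparison_triangle_def)
    ultimately have "dist m r \<le> dist m' r'"
      using assms(1) tri m(1) unfolding CAT0_def by blast
    then have "(dist m r)\<^sup>2 \<le> (dist m' r')\<^sup>2" by (simp add: power_mono)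
    \<comment> \<open>Length of the median from \<open>r'\<close>, obtained by expanding inner
      products.\<close>
    also have "\<dots> = ((dist p' r')\<^sup>2 + (dist q' r')\<^sup>2) / 2 - (dist p' q')\<^sup>2 / 4"
    proof -
      have "m' - r' = (1/2) *\<^sub>R ((p' - r') + (q' - r'))"
        by (simp add: m'_def midpoint_def vec_eq_iff field_simps)
      moreover have "p' - q' = (p' - r') - (q' - r')" by simp
      ultimately show ?thesis
        unfolding dist_norm power2_norm_eq_inner
        by (simp only: inner_simps) (simp add: inner_commute field_simps)
    qed
    finally show "(dist m r)\<^sup>2 \<le> ((dist p r)\<^sup>2 + (dist q r)\<^sup>2) / 2 - (dist p q)\<^sup>2 / 4"
      using tri by (simp add: comparison_triangle_def)
  qed
qed

section \<open>Minimising sums of squared distances\<close>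

lemma proper_space_sum_dist_minimiser:
  fixes f :: "'i \<Rightarrow> 'a::metric_space"
  assumes "proper_space X" "finite I" "i \<in> I" "f i \<in> X"
  obtains c where "c \<in> X"
    "\<And>z. z \<in> X \<Longrightarrow> (\<Sum>j\<in>I. (dist c (f j))\<^sup>2) \<le> (\<Sum>j\<in>I. (dist z (f j))\<^sup>2)"
proof -
  define F where "F z = (\<Sum>j\<in>I. (dist z (f j))\<^sup>2)" for z
  \<comment> \<open>The radius is chosen so that outside this ball the summand of \<open>i\<close>
    alone exceeds \<open>F (f i)\<close>; a minimum over the compact \<open>K\<close> is then a
    minimum over \<open>X\<close>.\<close>
  define K where "K = cball (f i) (sqrt (F (f i))) \<inter> X"
  have F0: "F z \<ge> 0" for z by (simp add: F_def sum_nonneg)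
  have fK: "f i \<in> K" using assms(4) F0 by (simp add: K_def)
  have "compact K" using assms(1,4) by (auto simp: K_def proper_space_def)
  moreover have "continuous_on K F" unfolding F_def by (intro continuous_intros)
  ultimately obtain c where c: "c \<in> K" "\<And>z. z \<in> K \<Longrightarrow> F c \<le> F z"
    using continuous_attains_inf[of K F] fK by blast
  have "F c \<le> F z" if z: "z \<in> X" for z
  proof (cases "z \<in> K")
    case False
    then have "sqrt (F (f i)) < dist z (f i)" using z by (auto simp: K_def dist_commute)
    then have "F (f i) < (dist z (f i))\<^sup>2"
      using real_le_rsqrt by (metis not_le)
    also have "\<dots> \<le> F z"
      unfolding F_def using assms(2,3) by (intro member_le_sum) auto
    finally show ?thesis using c(2)[OF fK] by simp
  qed (use c in auto)
  moreover have "c \<in> X" using c(1) by (simp add: K_def)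
  ultimately show thesis using that unfolding F_def by blast
qed

text \<open>Between two distinct minimisers, summing the Bruhat-Tits inequality over
  \<open>I\<close> gives a point whose value is lower by at least
  \<open>card I * ((dist c' c)\<^sup>2 / 4)\<close>, a positive amount.\<close>

lemma CAT0_sum_dist_minimiser_unique:
  fixes f :: "'i \<Rightarrow> 'a::metric_space"
  assumes "CAT0 X" "finite I" "I \<noteq> {}" "f ` I \<subseteq> X" "c \<in> X" "c' \<in> X"
    and "\<And>z. z \<in> X \<Longrightarrow> (\<Sum>j\<in>I. (dist c (f j))\<^sup>2) \<le> (\<Sum>j\<in>I. (dist z (f j))\<^sup>2)"
    and "(\<Sum>j\<in>I. (dist c' (f j))\<^sup>2) = (\<Sum>j\<in>I. (dist c (f j))\<^sup>2)"
  shows "c' = c"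
proof (rule ccontr)
  assume ne: "c' \<noteq> c"
  obtain m where m: "m \<in> X"
    "\<And>r. r \<in> X \<Longrightarrow> (dist m r)\<^sup>2 \<le> ((dist c' r)\<^sup>2 + (dist c r)\<^sup>2) / 2 - (dist c' c)\<^sup>2 / 4"
    using CAT0_Bruhat_Tits[OF assms(1,6,5) ne] by blast
  have "(\<Sum>j\<in>I. (dist m (f j))\<^sup>2)
      \<le> (\<Sum>j\<in>I. ((dist c' (f j))\<^sup>2 + (dist c (f j))\<^sup>2) / 2 - (dist c' c)\<^sup>2 / 4)"
    using assms(4) by (intro sum_mono m(2)) auto
  also have "\<dots> = (\<Sum>j\<in>I. (dist c (f j))\<^sup>2) - card I * ((dist c' c)\<^sup>2 / 4)"
    using assms(8) by (simp add: sum_subtractf sum.distrib flip: sum_divide_distrib)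
  also have "\<dots> < (\<Sum>j\<in>I. (dist c (f j))\<^sup>2)"
    using ne assms(2,3) by (simp add: card_gt_0_iff)
  finally show False using assms(7)[OF m(1)] by simp
qed

section \<open>Fixed points of finite groups of isometries\<close>

text \<open>Turns the group structure into pointwise facts on \<open>X\<close>, outside which the
  unit and the products are \<open>undefined\<close>. The map \<open>\<sigma>\<close> is left
  translation by \<open>g\<close>, needed to reindex sums over \<open>H\<close>.\<close>

lemma subgroup_isometry_group_act:
  assumes "subgroup H (isometry_group X)"
  shows "g \<in> H \<Longrightarrow> x \<in> X \<Longrightarrow> g x \<in> X"
    and "g \<in> H \<Longrightarrow> x \<in> X \<Longrightarrow> y \<in> X \<Longrightarrow> dist (g x) (g y) = dist x y"
    and "\<exists>e\<in>H. \<forall>x\<in>X. e x = x"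
    and "g \<in> H \<Longrightarrow> \<exists>\<sigma>. bij_betw \<sigma> H H \<and> (\<forall>h\<in>H. \<forall>x\<in>X. \<sigma> h x = g (h x))"
proof -
  let ?I = "isometry_group X"
  have sub: "H \<subseteq> carrier ?I" using assms by (rule subgroup.subset)
  then have HB: "H \<subseteq> Bij X" by (auto simp: isometry_group_def)
  have mult: "(g \<otimes>\<^bsub>?I\<^esub> h) x = g (h x)" if "g \<in> H" "h \<in> H" "x \<in> X" for g h x
    using that HB by (auto simp: isometry_group_def BijGroup_def compose_def)
  show "g \<in> H \<Longrightarrow> x \<in> X \<Longrightarrow> g x \<in> X"
    using HB by (auto simp: Bij_def bij_betw_def)
  show "g \<in> H \<Longrightarrow> x \<in> X \<Longrightarrow> y \<in> X \<Longrightarrow> dist (g x) (g y) = dist x y"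
    using sub by (auto simp: isometry_group_def)
  have "\<one>\<^bsub>?I\<^esub> \<in> H" using assms by (rule subgroup.one_closed)
  then show "\<exists>e\<in>H. \<forall>x\<in>X. e x = x"
    by (intro bexI[of _ "\<one>\<^bsub>?I\<^esub>"]) (auto simp: isometry_group_def BijGroup_def)
  assume g: "g \<in> H"
  interpret I: group ?I by (rule group_isometry_group)
  have gi: "inv\<^bsub>?I\<^esub> g \<in> H" using assms g by (rule subgroup.m_inv_closed)
  have "bij_betw (\<lambda>h. g \<otimes>\<^bsub>?I\<^esub> h) H H"
  proof (rule bij_betw_byWitness[where f' = "\<lambda>h. inv\<^bsub>?I\<^esub> g \<otimes>\<^bsub>?I\<^esub> h"])
    show "\<forall>h\<in>H. inv\<^bsub>?I\<^esub> g \<otimes>\<^bsub>?I\<^esub> (g \<otimes>\<^bsub>?I\<^esub> h) = h"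
      "\<forall>h\<in>H. g \<otimes>\<^bsub>?I\<^esub> (inv\<^bsub>?I\<^esub> g \<otimes>\<^bsub>?I\<^esub> h) = h"
      using g sub by (auto simp: subset_iff simp flip: I.m_assoc)
    show "(\<lambda>h. g \<otimes>\<^bsub>?I\<^esub> h) ` H \<subseteq> H" "(\<lambda>h. inv\<^bsub>?I\<^esub> g \<otimes>\<^bsub>?I\<^esub> h) ` H \<subseteq> H"
      using subgroup.m_closed[OF assms] g gi by auto
  qed
  then show "\<exists>\<sigma>. bij_betw \<sigma> H H \<and> (\<forall>h\<in>H. \<forall>x\<in>X. \<sigma> h x = g (h x))"
    using mult g by blast
qed

lemma finite_isometries_fixed_point_near:
  assumes "proper_space X" "CAT0 X" and H: "subgroup H (isometry_group X)" and fin: "finite H"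
    and x: "x \<in> almost_fixed X (\<lambda>g. g) H k" and k: "k \<ge> 0"
  obtains c where "c \<in> X" "\<And>h. h \<in> H \<Longrightarrow> h c = c" "dist c x \<le> k"
proof -
  note act = subgroup_isometry_group_act[OF H]
  have xX: "x \<in> X" and xk: "\<And>h. h \<in> H \<Longrightarrow> dist x (h x) \<le> k"
    using x by (auto simp: almost_fixed_def)
  \<comment> \<open>Any element will do: it shows that \<open>H\<close> is nonempty and supplies the
    centre \<open>e x\<close> of the ball in the minimisation.\<close>
  obtain e where e: "e \<in> H" using act(3) by blast
  obtain c where c: "c \<in> X"
    "\<And>z. z \<in> X \<Longrightarrow> (\<Sum>h\<in>H. (dist c (h x))\<^sup>2) \<le> (\<Sum>h\<in>H. (dist z (h x))\<^sup>2)"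
    using proper_space_sum_dist_minimiser[OF assms(1) fin e, of "\<lambda>h. h x"] act(1)[OF e xX] by blast
  have fixed: "g c = c" if g: "g \<in> H" for g
  proof (rule CAT0_sum_dist_minimiser_unique[OF assms(2) fin _ _ c(1) act(1)[OF g c(1)] c(2)])
    obtain \<sigma> where \<sigma>: "bij_betw \<sigma> H H" "\<And>h x. h \<in> H \<Longrightarrow> x \<in> X \<Longrightarrow> \<sigma> h x = g (h x)"
      using act(4)[OF g] by blast
    \<comment> \<open>Replacing \<open>h\<close> by its left translate turns each distance into one
      between images under \<open>g\<close>, which cancels as an isometry.\<close>
    have "(\<Sum>h\<in>H. (dist (g c) (h x))\<^sup>2) = (\<Sum>h\<in>H. (dist (g c) (\<sigma> h x))\<^sup>2)"
      using sum.reindex_bij_betw[OF \<sigma>(1), of "\<lambda>h. (dist (g c) (h x))\<^sup>2"] by simp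
    also have "\<dots> = (\<Sum>h\<in>H. (dist c (h x))\<^sup>2)"
      using \<sigma>(2) act(1,2) g c(1) xX by (intro sum.cong) auto
    finally show "(\<Sum>h\<in>H. (dist (g c) (h x))\<^sup>2) = (\<Sum>h\<in>H. (dist c (h x))\<^sup>2)" .
  qed (use e act(1) xX in auto)
  have "card H * (dist c x)\<^sup>2 = (\<Sum>h\<in>H. (dist c x)\<^sup>2)" by simp
  \<comment> \<open>Since \<open>h c = c\<close>, the distance from \<open>c\<close> to
    \<open>h x\<close> is that from \<open>h c\<close> to \<open>h x\<close>.\<close>
  also have "\<dots> = (\<Sum>h\<in>H. (dist c (h x))\<^sup>2)"
    using act(2)[OF _ c(1) xX] fixed by (intro sum.cong) (simp_all, metis)
  also have "\<dots> \<le> (\<Sum>h\<in>H. (dist x (h x))\<^sup>2)" by (rule c(2)[OF xX])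
  also have "\<dots> \<le> (\<Sum>h\<in>H. k\<^sup>2)" using xk by (intro sum_mono power_mono) auto
  also have "\<dots> = card H * k\<^sup>2" by simp
  finally have "(dist c x)\<^sup>2 \<le> k\<^sup>2" using fin e
    by (subst (asm) mult_le_cancel_left_pos) (auto simp: card_gt_0_iff)
  then have "dist c x \<le> k" using k by (rule power2_le_imp_le)
  then show thesis using that c(1) fixed by blast
qed

section \<open>From density to coarse equivalence and tameness\<close>

text \<open>A coarse inverse is any choice \<open>g\<close> of a point of \<open>A\<close> within
  \<open>k\<close> of each point of \<open>B\<close>; continuity is not asked for, and
  \<open>g\<close> changes distances by a bounded amount.\<close>

lemma coarse_equivalence_inclusion:
  fixes A B :: "'a::metric_space set"
  assumes "A \<subseteq> B" and k: "k \<ge> 0" and near: "\<And>b. b \<in> B \<Longrightarrow> \<exists>a\<in>A. dist a b \<le> k"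
  shows "coarse_equivalence A B (\<lambda>a. a)"
proof -
  obtain g where g: "\<And>b. b \<in> B \<Longrightarrow> g b \<in> A" "\<And>b. b \<in> B \<Longrightarrow> dist (g b) b \<le> k"
    using near by metis
  have "coarse_map A B (\<lambda>a. a)"
    using assms(1) unfolding coarse_map_def by (auto intro: bounded_subset)
  moreover have "coarse_map B A g"
    unfolding coarse_map_def
  proof (intro conjI allI impI)
    show "g \<in> B \<rightarrow> A" using g by auto
  next
    fix C assume "C \<subseteq> A" "bounded C"
    then obtain z r where zr: "\<And>y. y \<in> C \<Longrightarrow> dist z y \<le> r" unfolding bounded_def by blast
    have "dist z y \<le> r + k" if "y \<in> g -` C \<inter> B" for y
      using that zr[of "g y"] g(2)[of y] dist_triangle[of z y "g y"] by auto
    then show "bounded (g -` C \<inter> B)" unfolding bounded_def by blast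
  next
    fix R :: real assume R: "R > 0"
    \<comment> \<open>Each endpoint is displaced by at most \<open>k\<close>.\<close>
    have "dist (g x) (g y) \<le> R + 2 * k" if "x \<in> B" "y \<in> B" "dist x y \<le> R" for x y
      using that g(2)[of x] g(2)[of y] dist_triangle[of "g x" "g y" x] dist_triangle[of x "g y" y]
      by (simp add: dist_commute)
    then show "\<exists>S>0. \<forall>x\<in>B. \<forall>y\<in>B. dist x y \<le> R \<longrightarrow> dist (g x) (g y) \<le> S"
      using R k by (intro exI[of _ "R + 2 * k"]) auto
  qed
  ultimately show ?thesis
    using assms(1) g(2) unfolding coarse_equivalence_def by blast
qed

lemma finite_isometries_bounded_fixed_set:
  assumes "proper_space X" "CAT0 X" "subgroup H (isometry_group X)" "finite H"
  shows "is_bounded_fixed_set X (\<lambda>g. g) H {x \<in> X. \<forall>h\<in>H. h x = x}"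
  unfolding is_bounded_fixed_set_def
\<comment> \<open>Fixed points are displaced by 0, so any positive threshold could replace 1. The
  density constant is \<open>k\<close> itself, as the coarse equivalence may depend on
  \<open>k\<close>.\<close>
proof (intro exI[of _ 1] conjI allI impI)
  let ?Y = "{x \<in> X. \<forall>h\<in>H. h x = x}"
  show "?Y \<subseteq> almost_fixed X (\<lambda>g. g) H 1" by (auto simp: almost_fixed_def)
  fix k :: real assume k: "1 \<le> k"
  show "coarse_equivalence ?Y (almost_fixed X (\<lambda>g. g) H k) (\<lambda>y. y)"
  proof (rule coarse_equivalence_inclusion[of _ _ k])
    show "?Y \<subseteq> almost_fixed X (\<lambda>g. g) H k" using k by (auto simp: almost_fixed_def)
    show "\<exists>a\<in>?Y. dist a b \<le> k" if b: "b \<in> almost_fixed X (\<lambda>g. g) H k" for b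
    proof (rule finite_isometries_fixed_point_near[OF assms b])
      show "k \<ge> 0" using k by simp
    qed blast
  qed (use k in simp)
qed simp

theorem mainTheorem7:
  fixes X :: "'a::metric_space set" and G :: "('a \<Rightarrow> 'a) set"
  assumes "proper_space X" and "CAT0 X"
    and "subgroup G (isometry_group X)" and "finite G"
  shows "tame_action ((isometry_group X)\<lparr>carrier := G\<rparr>) X (\<lambda>g. g)"
  unfolding tame_action_def
proof (intro allI impI)
  fix H assume H: "subgroup H ((isometry_group X)\<lparr>carrier := G\<rparr>)"
  \<comment> \<open>A subgroup of \<open>G\<close> is again a finite subgroup of the full isometry
    group, so the fixed set result applies to it directly.\<close>
  have "subgroup H (isometry_group X)"
    using group.incl_subgroup[OF group_isometry_group assms(3) H] .
  moreover have "finite H"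
    using subgroup.subset[OF H] assms(4) by (auto intro: finite_subset)
  ultimately show "\<exists>Y. is_bounded_fixed_set X (\<lambda>g. g) H Y"
    using finite_isometries_bounded_fixed_set[OF assms(1,2)] by blast
qed

end
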